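(* Let $D$ be a degree sequence. Then $D$ excludes $C_4$ if and only if at least one of the following holds: (i) $D$ is forcibly chordal; (ii) there is a split graph $S$ with split partition $(A,B)$ such that $D$ is the degree sequence of $(S,A,B)\circ C_5$; (iii) there is a split graph $S$ with split partition $(A,B)$ such that $D$ is the degree sequence of $(S,A,B)\circ C_6$.
   Context: All graphs are finite and simple. The degree sequence $D(G)$ of a graph $G$ is the sequence of its vertex degrees listed in decreasing (i.e. non-increasing) order; $G$ is then called a realization of $D(G)$. A sequence of nonnegative integers is called a degree sequence if it is $D(G)$ for some graph $G$. For graphs, $G_1\sqsubseteq G_2$ means that $G_1$ is isomorphic to an induced subgraph of $G_2$. For degree sequences, $D_1\preceq D_2$ means that there are realizations $G_1$ of $D_1$ and $G_2$ of $D_2$ with $G_1\sqsubseteq G_2$. A degree sequence $D$ excludes a graph $G$ if $D(G)\not\preceq D$. $C_m$ denotes the cycle on $m$ vertices. A graph is chordal if every induced cycle is a triangle. A degree sequence $D$ is forcibly chordal if every realization of $D$ is chordal. A set of vertices is complete (anticomplete) if every two (no two) distinct vertices in it are adjacent. A graph $S$ is split if its vertex set has a partition $(A,B)$ with $A$ complete and $B$ anticomplete; such an $(A,B)$ is called a split partition of $S$. The sets $A$ and $B$ may be empty, and the graph with no vertices counts as a split graph. For a split graph $S$ with split partition $(A,B)$ and a graph $H$ (with vertex set disjoint from $V(S)$), $(S,A,B)\circ H$ is the graph with vertex set $V(S)\cup V(H)$ obtained from the disjoint union of $S$ and $H$ by making every vertex of $H$ adjacent to every vertex of $A$ and to no vertex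 of $B$. *)

theory Defs
  imports "Graph_Theory.Graph_Theory" "HOL-Library.Multiset"
begin

text \<open>
  Finite simple graphs are modelled by the locale \<open>pair_graph\<close>: a finite vertex set with a
  symmetric, irreflexive arc relation. An edge \<open>uv\<close> is the pair of arcs \<open>(u,v)\<close>, \<open>(v,u)\<close>,
  so the degree of a vertex is its \<open>out_degree\<close>.
\<close>

definition degree_sequence :: "'a pair_pre_digraph \<Rightarrow> nat list" where
  "degree_sequence G =
     rev (sorted_list_of_multiset (image_mset (out_degree (with_proj G)) (mset_set (pverts G))))"

definition realization :: "'a pair_pre_digraph \<Rightarrow> nat list \<Rightarrow> bool" where
  "realization G D \<longleftrightarrow> pair_graph G \<and> degree_sequence G = D"

text \<open>
  Wherever all realizations of a sequence are quantified over, vertices are natural numbers. By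
  \<open>realization_nat_copy\<close> below, this includes every finite graph up to isomorphism.
\<close>

definition is_degree_sequence :: "nat list \<Rightarrow> bool" where
  "is_degree_sequence D \<longleftrightarrow> (\<exists>G :: nat pair_pre_digraph. realization G D)"

definition induced_in :: "'a pair_pre_digraph \<Rightarrow> 'b pair_pre_digraph \<Rightarrow> bool" where
  "induced_in G1 G2 \<longleftrightarrow>
     (\<exists>H :: 'b pair_pre_digraph.
        induced_subgraph (with_proj H) (with_proj G2) \<and> digraph_iso (with_proj G1) (with_proj H))"

definition degree_sequence_le :: "nat list \<Rightarrow> nat list \<Rightarrow> bool" where
  "degree_sequence_le D1 D2 \<longleftrightarrow>
     (\<exists>(G1 :: nat pair_pre_digraph) (G2 :: nat pair_pre_digraph).
        realization G1 D1 \<and> realization G2 D2 \<and> induced_in G1 G2)"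

definition excludes :: "nat list \<Rightarrow> 'a pair_pre_digraph \<Rightarrow> bool" where
  "excludes D G \<longleftrightarrow> \<not> degree_sequence_le (degree_sequence G) D"

text \<open>The cycle on \<open>m\<close> vertices; meaningful for \<open>m \<ge> 3\<close> only.\<close>

definition cycle_graph :: "nat \<Rightarrow> nat pair_pre_digraph" where
  "cycle_graph m =
     \<lparr> pverts = {..<m},
       parcs = {(u, v). u < m \<and> v < m \<and> (v = Suc u mod m \<or> u = Suc v mod m)} \<rparr>"

definition chordal :: "'a pair_pre_digraph \<Rightarrow> bool" where
  "chordal G \<longleftrightarrow> (\<forall>m\<ge>3. induced_in (cycle_graph m) G \<longrightarrow> m = 3)"

definition forcibly_chordal :: "nat list \<Rightarrow> bool" where
  "forcibly_chordal D \<longleftrightarrow> (\<forall>G :: nat pair_pre_digraph. realization G D \<longrightarrow> chordal G)"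

definition complete_set :: "'a pair_pre_digraph \<Rightarrow> 'a set \<Rightarrow> bool" where
  "complete_set G X \<longleftrightarrow> (\<forall>u\<in>X. \<forall>v\<in>X. u \<noteq> v \<longrightarrow> (u, v) \<in> parcs G)"

definition anticomplete_set :: "'a pair_pre_digraph \<Rightarrow> 'a set \<Rightarrow> bool" where
  "anticomplete_set G X \<longleftrightarrow> (\<forall>u\<in>X. \<forall>v\<in>X. u \<noteq> v \<longrightarrow> (u, v) \<notin> parcs G)"

definition split_partition :: "'a pair_pre_digraph \<Rightarrow> 'a set \<Rightarrow> 'a set \<Rightarrow> bool" where
  "split_partition S A B \<longleftrightarrow>
     A \<union> B = pverts S \<and> A \<inter> B = {} \<and> complete_set S A \<and> anticomplete_set S B"

definition split_graph :: "'a pair_pre_digraph \<Rightarrow> bool" where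
  "split_graph S \<longleftrightarrow> pair_graph S \<and> (\<exists>A B. split_partition S A B)"

text \<open>
  The graph \<open>(S,A,B) \<circ> H\<close>; the sum type makes the vertex sets of \<open>S\<close> and \<open>H\<close> disjoint.
  \<open>B\<close> does not occur on the right-hand side, since no arcs between \<open>B\<close> and \<open>H\<close> are added.
\<close>

definition split_compose ::
    "'a pair_pre_digraph \<Rightarrow> 'a set \<Rightarrow> 'a set \<Rightarrow> 'b pair_pre_digraph \<Rightarrow> ('a + 'b) pair_pre_digraph" where
  "split_compose S A B H =
     \<lparr> pverts = pverts S <+> pverts H,
       parcs = {(Inl u, Inl v) | u v. (u, v) \<in> parcs S}
             \<union> {(Inr u, Inr v) | u v. (u, v) \<in> parcs H}
             \<union> {(Inl a, Inr h) | a h. a \<in> A \<and> h \<in> pverts H}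
             \<union> {(Inr h, Inl a) | a h. a \<in> A \<and> h \<in> pverts H} \<rparr>"

lemma pair_graph_iff:
  "pair_graph G \<longleftrightarrow>
     finite (pverts G) \<and> parcs G \<subseteq> pverts G \<times> pverts G \<and> sym (parcs G) \<and> irrefl (parcs G)"
proof
  assume "pair_graph G"
  then interpret pair_graph G .
  show "finite (pverts G) \<and> parcs G \<subseteq> pverts G \<times> pverts G \<and> sym (parcs G) \<and> irrefl (parcs G)"
    using pair_finite_verts pair_sym_arcs
    by (auto simp: symmetric_def irrefl_def dest: in_arcsD1 in_arcsD2 pair_no_loops)
next
  assume *: "finite (pverts G) \<and> parcs G \<subseteq> pverts G \<times> pverts G \<and> sym (parcs G) \<and> irrefl (parcs G)"
  then have "finite (parcs G)"
    by (meson finite_SigmaI finite_subset)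
  with * show "pair_graph G"
    by unfold_locales (auto simp: symmetric_def irrefl_def)
qed

lemma induced_in_iff:
  assumes "pair_graph G1" "pair_graph G2"
  shows "induced_in G1 G2 \<longleftrightarrow>
    (\<exists>f. inj_on f (pverts G1) \<and> f ` pverts G1 \<subseteq> pverts G2 \<and>
       (\<forall>u\<in>pverts G1. \<forall>v\<in>pverts G1. (u, v) \<in> parcs G1 \<longleftrightarrow> (f u, f v) \<in> parcs G2))"
  (is "_ \<longleftrightarrow> (\<exists>f. ?emb f)")
proof
  interpret G1: pair_graph G1 by fact
  assume "induced_in G1 G2"
  then obtain H h where ind: "induced_subgraph (with_proj H) (with_proj G2)"
    and h: "G1.digraph_isomorphism h" and H: "with_proj H = app_iso h (with_proj G1)"
    by (auto simp: induced_in_def digraph_iso_def)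
  have tl: "iso_tail h = fst" "iso_head h = snd"
    using H by (auto simp: with_proj_def app_iso_def)
  have vH: "pverts H = iso_verts h ` pverts G1" and aH: "parcs H = iso_arcs h ` parcs G1"
    using H by (auto simp: with_proj_def app_iso_def)
  have inj: "inj_on (iso_verts h) (pverts G1)"
    using h by (auto simp: G1.digraph_isomorphism_def)
  have arc: "iso_arcs h a = (iso_verts h (fst a), iso_verts h (snd a))" if "a \<in> parcs G1" for a
    using h that tl by (auto simp: G1.digraph_isomorphism_def prod_eq_iff)
  have sub: "pverts H \<subseteq> pverts G2"
    and arcs: "parcs H = {e \<in> parcs G2. fst e \<in> pverts H \<and> snd e \<in> pverts H}"
    using ind by (auto simp: induced_subgraph_def subgraph_def)
  have "(u, v) \<in> parcs G1 \<longleftrightarrow> (iso_verts h u, iso_verts h v) \<in> parcs G2"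
    if uv: "u \<in> pverts G1" "v \<in> pverts G1" for u v
  proof
    assume "(u, v) \<in> parcs G1"
    then have "(iso_verts h u, iso_verts h v) \<in> parcs H"
      using arc aH by force
    then show "(iso_verts h u, iso_verts h v) \<in> parcs G2"
      using arcs by auto
  next
    assume "(iso_verts h u, iso_verts h v) \<in> parcs G2"
    then have "(iso_verts h u, iso_verts h v) \<in> parcs H"
      using arcs vH uv by auto
    then obtain a where a: "a \<in> parcs G1" "(iso_verts h u, iso_verts h v) = iso_arcs h a"
      using aH by auto
    then have "iso_verts h u = iso_verts h (fst a)" "iso_verts h v = iso_verts h (snd a)"
      using arc by auto
    then have "a = (u, v)"
      using inj uv a(1) G1.in_arcsD1 G1.in_arcsD2 by (cases a) (auto dest: inj_onD)
    then show "(u, v) \<in> parcs G1" using a by simp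
  qed
  then show "\<exists>f. ?emb f"
    using inj sub vH by (intro exI[of _ "iso_verts h"]) auto
next
  interpret G1: pair_graph G1 by fact
  interpret G2: pair_graph G2 by fact
  assume "\<exists>f. ?emb f"
  then obtain f where f: "?emb f" by blast
  define H where "H = \<lparr> pverts = f ` pverts G1, parcs = map_prod f f ` parcs G1 \<rparr>"
  define h where "h = \<lparr> iso_verts = f, iso_arcs = map_prod f f, iso_head = snd, iso_tail = fst \<rparr>"
  have arcs: "parcs H = {e \<in> parcs G2. fst e \<in> pverts H \<and> snd e \<in> pverts H}"
  proof (rule set_eqI, rule iffI)
    fix e assume "e \<in> parcs H"
    then obtain u v where uv: "(u, v) \<in> parcs G1" "e = (f u, f v)" by (auto simp: H_def)
    then have "u \<in> pverts G1" "v \<in> pverts G1" by (auto dest: G1.in_arcsD1 G1.in_arcsD2)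
    then show "e \<in> {e \<in> parcs G2. fst e \<in> pverts H \<and> snd e \<in> pverts H}"
      using f uv by (simp add: H_def)
  next
    fix e assume "e \<in> {e \<in> parcs G2. fst e \<in> pverts H \<and> snd e \<in> pverts H}"
    then obtain u v where uv: "u \<in> pverts G1" "v \<in> pverts G1" "e = (f u, f v)" "(f u, f v) \<in> parcs G2"
      by (cases e) (auto simp: H_def)
    then have "(u, v) \<in> parcs G1" using f by blast
    then have "map_prod f f (u, v) \<in> map_prod f f ` parcs G1" by (rule imageI)
    then show "e \<in> parcs H" using uv by (simp add: H_def)
  qed
  have "inj_on (map_prod f f) (pverts G1 \<times> pverts G1)"
    using f by (auto intro: map_prod_inj_on)
  then have inj: "inj_on (map_prod f f) (parcs G1)"
    by (rule inj_on_subset) (auto dest: G1.in_arcsD1 G1.in_arcsD2)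
  have "G1.digraph_isomorphism h"
    using f inj G1.wf_digraph_axioms by (auto simp: G1.digraph_isomorphism_def h_def)
  moreover have "with_proj H = app_iso h (with_proj G1)"
    by (simp add: with_proj_def H_def h_def app_iso_def)
  ultimately have "digraph_iso (with_proj G1) (with_proj H)"
    by (auto simp: digraph_iso_def)
  moreover have "wf_digraph (with_proj H)"
    by unfold_locales (use arcs in auto)
  then have "induced_subgraph (with_proj H) (with_proj G2)"
    using arcs f G2.wf_digraph_axioms
    by (auto simp: induced_subgraph_def subgraph_def compatible_def) (auto simp: H_def)
  ultimately show "induced_in G1 G2"
    by (auto simp: induced_in_def)
qed

lemma pair_graph_cycle_graph:
  assumes "m \<ge> 3"
  shows "pair_graph (cycle_graph m)"
proof -
  have "Suc u mod m \<noteq> u" for u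
  proof
    assume *: "Suc u mod m = u"
    then have "u < m" using assms by (metis mod_less_divisor not_numeral_le_zero not_gr_zero)
    then show False using * assms by (cases "Suc u = m") auto
  qed
  then show ?thesis
    by (auto simp: pair_graph_iff cycle_graph_def sym_def irrefl_def dest: sym)
qed

lemma pair_graph_split_compose:
  assumes "pair_graph S" "split_partition S A B" "pair_graph H"
  shows "pair_graph (split_compose S A B H)"
  using assms
  by (auto simp: pair_graph_iff split_compose_def split_partition_def sym_def irrefl_def)

lemma realization_nat_copy:
  assumes "realization G D"
  shows "\<exists>G' :: nat pair_pre_digraph.
    realization G' D \<and> digraph_iso (with_proj G) (with_proj G')"
proof -
  have G: "pair_graph G" and D: "degree_sequence G = D"
    using assms by (auto simp: realization_def)
  interpret pair_graph G by (rule G)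
  obtain f :: "'a \<Rightarrow> nat" where f: "inj_on f (pverts G)"
    using pair_finite_verts finite_imp_inj_to_nat_seg by meson
  define G' where "G' = \<lparr> pverts = f ` pverts G, parcs = map_prod f f ` parcs G \<rparr>"
  define h where "h = \<lparr> iso_verts = f, iso_arcs = map_prod f f, iso_head = snd, iso_tail = fst \<rparr>"
  have "inj_on (map_prod f f) (pverts G \<times> pverts G)"
    using f by (auto intro: map_prod_inj_on)
  then have inj: "inj_on (map_prod f f) (parcs G)"
    by (rule inj_on_subset) (auto dest: in_arcsD1 in_arcsD2)
  have "digraph_isomorphism h"
    using f inj wf_digraph_axioms by (auto simp: digraph_isomorphism_def h_def)
  moreover have "with_proj G' = app_iso h (with_proj G)"
    by (simp add: with_proj_def G'_def h_def app_iso_def)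
  ultimately have iso: "digraph_iso (with_proj G) (with_proj G')"
    by (auto simp: digraph_iso_def)
  have G': "pair_graph G'"
    using G f unfolding pair_graph_iff G'_def
    by (auto simp: sym_def irrefl_def dest: inj_onD)
  have "out_degree (with_proj G') (f v) = out_degree (with_proj G) v" if "v \<in> pverts G" for v
  proof -
    have "out_arcs (with_proj G') (f v) = map_prod f f ` out_arcs (with_proj G) v"
    proof (rule set_eqI, rule iffI)
      fix e assume "e \<in> out_arcs (with_proj G') (f v)"
      then obtain x y where xy: "(x, y) \<in> parcs G" "e = (f x, f y)" "f x = f v"
        by (auto simp: out_arcs_def G'_def)
      then have "x = v" using f that in_arcsD1 inj_onD by metis
      then have "(v, y) \<in> out_arcs (with_proj G) v" "e = map_prod f f (v, y)"
        using xy by (auto simp: out_arcs_def)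
      then show "e \<in> map_prod f f ` out_arcs (with_proj G) v" by blast
    qed (auto simp: out_arcs_def G'_def)
    moreover have "inj_on (map_prod f f) (out_arcs (with_proj G) v)"
      by (rule inj_on_subset[OF inj]) (auto simp: out_arcs_def)
    ultimately show ?thesis
      by (simp add: out_degree_def card_image)
  qed
  moreover have "mset_set (pverts G') = image_mset f (mset_set (pverts G))"
    using f by (simp add: G'_def image_mset_mset_set)
  ultimately have "degree_sequence G' = degree_sequence G"
    using pair_finite_verts
    by (auto simp: degree_sequence_def multiset.map_comp
        intro!: arg_cong[where f = sorted_list_of_multiset] image_mset_cong)
  then show ?thesis
    using D G' iso by (auto simp: realization_def)
qed

end

theory Submission
  imports Defs "HOL-Combinatorics.Permutations"
begin

text \<open>
  Replacing an induced subgraph by another graph with the same vertices and degrees preserves the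
  degree sequence, so if \<open>D\<close> excludes \<open>C\<^sub>4\<close>, no realization contains an induced subgraph \<open>P\<close> whose
  degrees can be rearranged to produce a \<open>C\<^sub>4\<close> (\<open>squarable\<close> below). The path on six vertices is such a
  \<open>P\<close>, so an induced cycle of length at least four in a realization has length 5 or 6. Adding to this
  cycle a vertex adjacent to some but not all of its vertices, or a disjoint edge, also gives such a
  \<open>P\<close>; hence every other vertex is complete or anticomplete to the cycle, the anticomplete ones form
  an anticomplete set, and the complete ones a complete set, since two nonadjacent ones lie on a \<open>C\<^sub>4\<close>.

  Conversely, for disjoint sets \<open>A\<close>, \<open>B\<close>, \<open>H\<close> covering the vertices, the degree sum over \<open>A\<close> is at most
  \<open>|A| (|A| + |H| - 1)\<close> plus the degree sum over \<open>B\<close>, with equality iff the graph \<open>G\<close> is \<open>(S,A,B) \<circ> G[H]\<close>.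
  So every realization of the degree sequence of \<open>(S,A,B) \<circ> C\<^sub>m\<close> is \<open>(S',A',B') \<circ> H'\<close> with \<open>H'\<close>
  2-regular on \<open>m\<close> vertices. A \<open>C\<^sub>4\<close> would lie inside \<open>H'\<close>, which is too small when \<open>m\<close> is 5 or 6.
\<close>

section \<open>Degrees and degree sequences\<close>

abbreviation nbhd :: "'a pair_pre_digraph \<Rightarrow> 'a \<Rightarrow> 'a set" where
  "nbhd G v \<equiv> parcs G `` {v}"

lemma out_degree_with_proj: "out_degree (with_proj G) v = card (nbhd G v)"
proof -
  have "out_arcs (with_proj G) v = Pair v ` nbhd G v"
    by (auto simp: out_arcs_def)
  then show ?thesis
    by (simp add: out_degree_def card_image inj_on_def)
qed

lemma mset_degree_sequence:
  "mset (degree_sequence G) = image_mset (\<lambda>v. card (nbhd G v)) (mset_set (pverts G))"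
  by (simp add: degree_sequence_def flip: out_degree_with_proj)

lemma degree_sequence_eq_iff:
  "degree_sequence G = degree_sequence H \<longleftrightarrow>
     image_mset (\<lambda>v. card (nbhd G v)) (mset_set (pverts G)) =
     image_mset (\<lambda>v. card (nbhd H v)) (mset_set (pverts H))"
  by (metis mset_degree_sequence degree_sequence_def mset_rev mset_sorted_list_of_multiset)

lemma degree_sequence_eqI:
  assumes "bij_betw f (pverts G) (pverts H)"
    and "\<And>v. v \<in> pverts G \<Longrightarrow> card (nbhd H (f v)) = card (nbhd G v)"
  shows "degree_sequence G = degree_sequence H"
proof -
  have "mset_set (pverts H) = image_mset f (mset_set (pverts G))"
    using assms(1) by (auto simp: bij_betw_def image_mset_mset_set)
  moreover have "v \<in> pverts G" if "v \<in># mset_set (pverts G)" for v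
    using that by (cases "finite (pverts G)") auto
  ultimately show ?thesis
    using assms(2)
    by (auto simp: degree_sequence_eq_iff multiset.map_comp intro!: image_mset_cong)
qed

text \<open>Equal degree multisets give equally many vertices, hence some bijection
  \<open>g\<close>. It need not respect degrees; a permutation \<open>p\<close> of
  \<open>pverts G\<close> matching the two families of degrees corrects it to
  \<open>g \<circ> p\<close>.\<close>

lemma degree_sequence_eqE:
  assumes "degree_sequence G = degree_sequence H" "finite (pverts G)" "finite (pverts H)"
  obtains f where "bij_betw f (pverts G) (pverts H)"
    and "\<And>v. v \<in> pverts G \<Longrightarrow> card (nbhd H (f v)) = card (nbhd G v)"
proof -
  note eq = assms(1)[unfolded degree_sequence_eq_iff]
  have "card (pverts G) = card (pverts H)"
    using arg_cong[OF eq, of size] by simp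
  then obtain g where g: "bij_betw g (pverts G) (pverts H)"
    using assms finite_same_card_bij by blast
  then have "mset_set (pverts H) = image_mset g (mset_set (pverts G))"
    by (auto simp: bij_betw_def image_mset_mset_set)
  then have "image_mset (\<lambda>v. card (nbhd G v)) (mset_set (pverts G)) =
      image_mset (\<lambda>v. card (nbhd H (g v))) (mset_set (pverts G))"
    using eq by (simp add: multiset.map_comp comp_def)
  then obtain p where p: "p permutes pverts G"
    "\<forall>v\<in>pverts G. card (nbhd G v) = card (nbhd H (g (p v)))"
    using image_mset_eq_implies_permutes[OF assms(2)] by blast
  show thesis
  proof (rule that)
    show "bij_betw (g \<circ> p) (pverts G) (pverts H)"
      using bij_betw_trans[OF permutes_imp_bij[OF p(1)] g] .
  qed (use p(2) in simp)
qed

lemma pair_graph_nbhd: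
  assumes "pair_graph G"
  shows "finite (nbhd G v)" "nbhd G v \<subseteq> pverts G" "v \<notin> nbhd G v"
    "u \<in> nbhd G v \<longleftrightarrow> v \<in> nbhd G u"
proof -
  show sub: "nbhd G v \<subseteq> pverts G"
    using assms by (auto simp: pair_graph_iff)
  show "finite (nbhd G v)"
    using assms finite_subset[OF sub] by (auto simp: pair_graph_iff)
qed (use assms in \<open>auto simp: pair_graph_iff irrefl_def dest: symD\<close>)

section \<open>Induced four-cycles and the exclusion of C4\<close>

text \<open>In a \<open>pair_graph\<close> the reversed arcs and the distinctness of consecutive
  vertices follow from symmetry and irreflexivity, so this describes an induced C4 by named
  vertices.\<close>

definition has_square :: "'a pair_pre_digraph \<Rightarrow> bool" where
  "has_square G \<longleftrightarrow> (\<exists>a b c d. a \<noteq> c \<and> b \<noteq> d \<and>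
     (a, b) \<in> parcs G \<and> (b, c) \<in> parcs G \<and> (c, d) \<in> parcs G \<and> (d, a) \<in> parcs G \<and>
     (a, c) \<notin> parcs G \<and> (b, d) \<notin> parcs G)"

lemma has_squareI:
  assumes "(a, b) \<in> parcs G" "(b, c) \<in> parcs G" "(c, d) \<in> parcs G" "(d, a) \<in> parcs G"
    and "(a, c) \<notin> parcs G" "(b, d) \<notin> parcs G" "a \<noteq> c" "b \<noteq> d"
  shows "has_square G"
  using assms unfolding has_square_def by blast

text \<open>Removing \<open>mod\<close> lets the simplifier decide adjacency in concrete cycles and
  in cycles of symbolic length.\<close>

lemma cycle_graph_arc_iff:
  "(u, v) \<in> parcs (cycle_graph m) \<longleftrightarrow> u < m \<and> v < m \<and>
     (v = Suc u \<or> u = Suc v \<or> u = 0 \<and> Suc v = m \<or> v = 0 \<and> Suc u = m)"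
proof -
  have "y = Suc x mod m \<longleftrightarrow> y = Suc x \<or> y = 0 \<and> Suc x = m" if "x < m" "y < m" for x y
  proof (cases "Suc x = m")
    case True
    then show ?thesis
      using that by simp
  next
    case False
    then show ?thesis
      using that mod_less[of "Suc x" m] by simp
  qed
  from this[of u v] this[of v u] show ?thesis
    unfolding cycle_graph_def by auto
qed

lemma pverts_cycle_graph [simp]: "pverts (cycle_graph m) = {..<m}"
  by (simp add: cycle_graph_def)

lemma card_nbhd_cycle_graph:
  assumes "m \<ge> 3" "v < m"
  shows "card (nbhd (cycle_graph m) v) = 2"
proof -
  have "nbhd (cycle_graph m) v = {if Suc v = m then 0 else Suc v, if v = 0 then m - 1 else v - 1}"
    using assms by (auto simp: cycle_graph_arc_iff)
  moreover have "(if Suc v = m then 0 else Suc v) \<noteq> (if v = 0 then m - 1 else v - 1)"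
    using assms by auto
  ultimately show ?thesis
    by simp
qed

lemma less_4_iff: "n < 4 \<longleftrightarrow> n = 0 \<or> n = 1 \<or> n = 2 \<or> n = (3 :: nat)"
  by auto

lemma has_square_iff_induced_in:
  assumes "pair_graph G"
  shows "has_square G \<longleftrightarrow> induced_in (cycle_graph 4) G"
proof
  assume "has_square G"
  then obtain a b c d where sq: "a \<noteq> c" "b \<noteq> d"
    "(a, b) \<in> parcs G" "(b, c) \<in> parcs G" "(c, d) \<in> parcs G" "(d, a) \<in> parcs G"
    "(a, c) \<notin> parcs G" "(b, d) \<notin> parcs G"
    unfolding has_square_def by blast
  then have sq': "(b, a) \<in> parcs G" "(c, b) \<in> parcs G" "(d, c) \<in> parcs G" "(a, d) \<in> parcs G"
    "(c, a) \<notin> parcs G" "(d, b) \<notin> parcs G" "\<And>x. (x, x) \<notin> parcs G"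
    "{a, b, c, d} \<subseteq> pverts G"
    using assms by (auto simp: pair_graph_iff sym_def irrefl_def)
  then have "a \<noteq> b" "b \<noteq> c" "c \<noteq> d" "d \<noteq> a"
    using sq by auto
  then have "inj_on (nth [a, b, c, d]) {..<4}"
    using sq by (intro inj_on_nth) auto
  moreover have "nth [a, b, c, d] ` {..<4} \<subseteq> pverts G"
    using sq'(8) by (auto simp: less_4_iff)
  moreover have "(u, v) \<in> parcs (cycle_graph 4) \<longleftrightarrow> ([a, b, c, d] ! u, [a, b, c, d] ! v) \<in> parcs G"
    if "u < 4" "v < 4" for u v
    using that unfolding less_4_iff by (elim disjE; simp add: cycle_graph_arc_iff sq sq')
  ultimately show "induced_in (cycle_graph 4) G"
    using induced_in_iff[OF pair_graph_cycle_graph[of 4] assms]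
    by (auto intro!: exI[of _ "nth [a, b, c, d]"])
next
  assume "induced_in (cycle_graph 4) G"
  then obtain f where inj: "inj_on f {..<4}" and
    f: "\<And>u v. u < 4 \<Longrightarrow> v < 4 \<Longrightarrow> (u, v) \<in> parcs (cycle_graph 4) \<longleftrightarrow> (f u, f v) \<in> parcs G"
    using assms
    by (subst (asm) induced_in_iff) (auto simp: pair_graph_cycle_graph)
  show "has_square G"
    by (rule has_squareI[of "f 0" "f 1" _ "f 2" "f 3"])
      (use inj in \<open>simp_all add: f[symmetric] cycle_graph_arc_iff inj_on_eq_iff\<close>)
qed

lemma has_square_mono:
  assumes "induced_in G1 G2" "pair_graph G1" "pair_graph G2" "has_square G1"
  shows "has_square G2"
proof -
  obtain f where inj: "inj_on f (pverts G1)"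
    and f: "\<forall>u\<in>pverts G1. \<forall>v\<in>pverts G1. (u, v) \<in> parcs G1 \<longleftrightarrow> (f u, f v) \<in> parcs G2"
    using assms(1) induced_in_iff[OF assms(2,3)] by auto
  obtain a b c d where sq: "a \<noteq> c" "b \<noteq> d"
    "(a, b) \<in> parcs G1" "(b, c) \<in> parcs G1" "(c, d) \<in> parcs G1" "(d, a) \<in> parcs G1"
    "(a, c) \<notin> parcs G1" "(b, d) \<notin> parcs G1"
    using assms(4) unfolding has_square_def by blast
  then have "a \<in> pverts G1" "b \<in> pverts G1" "c \<in> pverts G1" "d \<in> pverts G1"
    using assms(2) by (auto simp: pair_graph_iff)
  then show ?thesis
    using sq f inj by (intro has_squareI[of "f a" "f b" _ "f c" "f d"]) (auto dest: inj_onD)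
qed

text \<open>A 2-regular graph on four vertices is a C4: if \<open>a\<close> has neighbours
  \<open>b\<close> and \<open>d\<close>, the remaining vertex \<open>c\<close> misses
  \<open>a\<close> and so sees exactly \<open>b\<close> and \<open>d\<close>, which fills up the
  neighbourhood of \<open>b\<close> and leaves \<open>b\<close> and \<open>d\<close>
  nonadjacent.\<close>

lemma has_square_of_realization_cycle_4:
  fixes G :: "'a pair_pre_digraph"
  assumes "realization G (degree_sequence (cycle_graph 4))"
  shows "has_square G"
proof -
  have G: "pair_graph G" and deq: "degree_sequence (cycle_graph 4) = degree_sequence G"
    using assms by (auto simp: realization_def)
  then have fin: "finite (pverts G)"
    by (simp add: pair_graph_iff)
  obtain f where f: "bij_betw f {..<4} (pverts G)"
    and deg: "\<And>v. v < 4 \<Longrightarrow> card (nbhd G (f v)) = card (nbhd (cycle_graph 4) v)"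
    using degree_sequence_eqE[OF deq _ fin] by (auto simp: cycle_graph_def)
  have c4: "card (pverts G) = 4"
    using bij_betw_same_card[OF f] by simp
  have deg2: "card (nbhd G x) = 2" if "x \<in> pverts G" for x
  proof -
    obtain v where "v < 4" "x = f v"
      using f \<open>x \<in> pverts G\<close> unfolding bij_betw_def by blast
    then show ?thesis
      using deg card_nbhd_cycle_graph[of 4] by simp
  qed
  obtain a where a: "a \<in> pverts G"
    using c4 by fastforce
  obtain b d where bd: "nbhd G a = {b, d}" "b \<noteq> d"
    using deg2[OF a] by (auto simp: card_2_iff)
  have "{b, d} \<subseteq> pverts G" "a \<notin> {b, d}"
    using pair_graph_nbhd[OF G, of a] bd by auto
  then have "card (pverts G - {a, b, d}) = 1"
    using c4 a bd(2) by (subst card_Diff_subset) auto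
  then obtain c where c: "pverts G - {a, b, d} = {c}"
    by (auto simp: card_1_singleton_iff)
  then have V: "pverts G = {a, b, c, d}" "c \<noteq> a" "c \<noteq> b" "c \<noteq> d"
    using a \<open>{b, d} \<subseteq> pverts G\<close> by auto
  have "a \<notin> nbhd G c"
    using bd V pair_graph_nbhd(4)[OF G, of c a] by auto
  then have "nbhd G c \<subseteq> {b, d}"
    using V pair_graph_nbhd(2,3)[OF G, of c] by auto
  moreover have "card (nbhd G c) = card {b, d}"
    using deg2[of c] V bd(2) by simp
  ultimately have c': "nbhd G c = {b, d}"
    using card_subset_eq[of "{b, d}" "nbhd G c"] by simp
  have "{a, c} \<subseteq> nbhd G b"
    using bd c' pair_graph_nbhd(4)[OF G, of b] by auto
  moreover have "card (nbhd G b) = card {a, c}"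
    using deg2[of b] V by simp
  ultimately have "nbhd G b = {a, c}"
    using card_subset_eq[OF pair_graph_nbhd(1)[OF G, of b]] by metis
  then have "d \<notin> nbhd G b"
    using V \<open>a \<notin> {b, d}\<close> by auto
  have "(a, b) \<in> parcs G" "(a, d) \<in> parcs G" "(c, b) \<in> parcs G" "(c, d) \<in> parcs G"
    using bd(1) c' by blast+
  moreover have "sym (parcs G)"
    using G by (simp add: pair_graph_iff)
  ultimately show ?thesis
    using \<open>d \<notin> nbhd G b\<close> \<open>a \<notin> nbhd G c\<close> V bd(2)
    by (intro has_squareI[of a b _ c d]) (auto dest: symD)
qed

text \<open>Since every realization of the degree sequence of C4 already contains an induced C4, the
  choice of \<open>G1\<close> in \<open>degree_sequence_le\<close> is immaterial.\<close>

lemma excludes_cycle_4_iff: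
  "excludes D (cycle_graph 4) \<longleftrightarrow>
     (\<forall>G :: nat pair_pre_digraph. realization G D \<longrightarrow> \<not> has_square G)"
proof -
  have "degree_sequence_le (degree_sequence (cycle_graph 4)) D \<longleftrightarrow>
    (\<exists>G :: nat pair_pre_digraph. realization G D \<and> has_square G)" (is "?L \<longleftrightarrow> ?R")
  proof
    assume ?L
    then show ?R
      using has_square_of_realization_cycle_4 has_square_mono
      unfolding degree_sequence_le_def realization_def by blast
  next
    assume ?R
    then obtain G :: "nat pair_pre_digraph" where "realization G D" "has_square G" by blast
    moreover have "realization (cycle_graph 4) (degree_sequence (cycle_graph 4))"
      by (simp add: realization_def pair_graph_cycle_graph)
    ultimately show ?L
      using has_square_iff_induced_in unfolding degree_sequence_le_def realization_def by blast
  qed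
  then show ?thesis
    by (auto simp: excludes_def)
qed

section \<open>Degree-preserving replacement\<close>

text \<open>Degrees must agree vertex by vertex, not just as multisets. Only then does replacing
  \<open>P\<close> by \<open>Q\<close> inside a larger graph preserve all degrees there.\<close>

definition squarable :: "'a pair_pre_digraph \<Rightarrow> bool" where
  "squarable P \<longleftrightarrow> (\<exists>Q. pair_graph Q \<and> pverts Q = pverts P \<and> has_square Q \<and>
     (\<forall>v\<in>pverts P. card (nbhd Q v) = card (nbhd P v)))"

lemma has_square_imp_squarable:
  assumes "pair_graph G" "has_square G"
  shows "squarable G"
  using assms unfolding squarable_def by blast

lemma squarable_imp_not_excludes:
  fixes G :: "nat pair_pre_digraph"
  assumes "squarable G"
  shows "\<not> excludes (degree_sequence G) (cycle_graph 4)"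
proof -
  obtain Q where Q: "pair_graph Q" "pverts Q = pverts G" "has_square Q"
    "\<And>v. v \<in> pverts G \<Longrightarrow> card (nbhd Q v) = card (nbhd G v)"
    using assms unfolding squarable_def by blast
  then have "degree_sequence G = degree_sequence Q"
    by (intro degree_sequence_eqI[of id]) auto
  then show ?thesis
    unfolding excludes_cycle_4_iff realization_def using Q by metis
qed

text \<open>Let \<open>W\<close> be the copy of \<open>P\<close> in \<open>G\<close>. Replacing the
  arcs within \<open>W\<close> by a copy of \<open>Q\<close> and keeping all others leaves every
  degree unchanged, while the C4 of \<open>Q\<close> stays induced because nothing else runs inside
  \<open>W\<close>.\<close>

lemma squarable_mono:
  assumes "induced_in P G" "pair_graph P" "pair_graph G" "squarable P"
  shows "squarable G"
proof -
  obtain f where inj: "inj_on f (pverts P)" and sub: "f ` pverts P \<subseteq> pverts G"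
    and f: "\<forall>u\<in>pverts P. \<forall>v\<in>pverts P. (u, v) \<in> parcs P \<longleftrightarrow> (f u, f v) \<in> parcs G"
    using assms(1) induced_in_iff[OF assms(2,3)] by auto
  obtain Q where Q: "pair_graph Q" "pverts Q = pverts P" "has_square Q"
    and deg: "\<And>v. v \<in> pverts P \<Longrightarrow> card (nbhd Q v) = card (nbhd P v)"
    using assms(4) unfolding squarable_def by blast
  define W where "W = f ` pverts P"
  have Wsub: "W \<subseteq> pverts G"
    using sub by (simp add: W_def)
  define G' where "G' = \<lparr>pverts = pverts G, parcs = (parcs G - W \<times> W) \<union> map_prod f f ` parcs Q\<rparr>"
  have QV: "parcs Q \<subseteq> pverts P \<times> pverts P"
    using Q by (auto simp: pair_graph_iff)
  then have RW: "map_prod f f ` parcs Q \<subseteq> W \<times> W"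
    by (auto simp: W_def)
  have "irrefl (map_prod f f ` parcs Q)"
    using Q inj QV by (fastforce simp: pair_graph_iff irrefl_def inj_on_def)
  moreover have "sym (map_prod f f ` parcs Q)"
    using Q by (auto simp: pair_graph_iff sym_def)
  moreover have "sym (parcs G - W \<times> W)"
    using assms(3) by (auto simp: pair_graph_iff sym_def)
  ultimately have "sym (parcs G')" "irrefl (parcs G')"
    using assms(3) by (auto simp: G'_def pair_graph_iff irrefl_def intro!: sym_Un)
  moreover have "parcs G' \<subseteq> pverts G' \<times> pverts G'"
    using assms(3) RW Sigma_mono[OF Wsub Wsub] by (simp add: G'_def pair_graph_iff) blast
  ultimately have G': "pair_graph G'"
    using assms(3) by (simp add: pair_graph_iff G'_def)
  have emb: "(f u, f v) \<in> parcs G' \<longleftrightarrow> (u, v) \<in> parcs Q" if "u \<in> pverts P" "v \<in> pverts P" for u v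
  proof -
    have "(f u, f v) \<in> map_prod f f ` parcs Q \<longleftrightarrow> (u, v) \<in> parcs Q"
      using inj_on_image_mem_iff[OF map_prod_inj_on[OF inj inj], of "(u, v)" "parcs Q"] that QV by simp
    then show ?thesis
      using that by (simp add: G'_def W_def)
  qed
  have "induced_in Q G'"
    unfolding induced_in_iff[OF Q(1) G'] using inj sub emb by (intro exI[of _ f]) (auto simp: Q G'_def)
  then have "has_square G'"
    using has_square_mono Q(1,3) G' by blast
  moreover have "card (nbhd G' x) = card (nbhd G x)" for x
  proof (cases "x \<in> W")
    case False
    then have "nbhd G' x = nbhd G x"
      using RW by (auto simp: G'_def)
    then show ?thesis by simp
  next
    case True
    then obtain v where v: "v \<in> pverts P" "x = f v" by (auto simp: W_def)
    \<comment> \<open>For a vertex of \<open>W\<close> the neighbours outside \<open>W\<close> are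
      untouched, and those inside are the image of a neighbourhood in \<open>Q\<close> instead of
      \<open>P\<close>, of the same size.\<close>
    have G'x: "nbhd G' x = (nbhd G x - W) \<union> f ` nbhd Q v"
    proof (rule set_eqI)
      fix y
      show "y \<in> nbhd G' x \<longleftrightarrow> y \<in> (nbhd G x - W) \<union> f ` nbhd Q v"
      proof (cases "y \<in> W")
        case True
        then obtain u where u: "u \<in> pverts P" "y = f u" by (auto simp: W_def)
        have "y \<in> f ` nbhd Q v \<longleftrightarrow> u \<in> nbhd Q v"
          unfolding u(2) using inj_on_image_mem_iff[OF inj u(1)] QV by auto
        then show ?thesis
          using emb u v True by simp
      next
        case False
        then show ?thesis
          using RW QV by (auto simp: G'_def W_def)
      qed
    qed
    have Gx: "nbhd G x = (nbhd G x - W) \<union> f ` nbhd P v"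
      using v f pair_graph_nbhd(2)[OF assms(2), of v] by (auto simp: W_def)
    have sub: "nbhd Q v \<subseteq> pverts P" "nbhd P v \<subseteq> pverts P"
      using pair_graph_nbhd(2)[OF assms(2)] pair_graph_nbhd(2)[OF Q(1)] Q(2) by auto
    then have "card (f ` nbhd Q v) = card (f ` nbhd P v)"
      using deg[OF v(1)] card_image inj_on_subset[OF inj] by metis
    moreover have "card ((nbhd G x - W) \<union> f ` T) = card (nbhd G x - W) + card (f ` T)"
      if "T \<subseteq> pverts P" for T
      using that assms(2) pair_graph_nbhd(1)[OF assms(3)] finite_subset[OF that]
      by (intro card_Un_disjoint) (auto simp: W_def pair_graph_iff)
    ultimately show ?thesis
      using sub G'x Gx by metis
  qed
  ultimately show ?thesis
    using G' unfolding squarable_def by (intro exI[of _ G']) (auto simp: G'_def)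
qed

section \<open>Embeddings and rotations of cycles\<close>

text \<open>Unlike \<open>induced_in\<close>, this names the vertex map, so that a cycle in
  \<open>G\<close> can be rotated by composition and extended by further vertices.\<close>

definition embedding :: "('a \<Rightarrow> 'b) \<Rightarrow> 'a pair_pre_digraph \<Rightarrow> 'b pair_pre_digraph \<Rightarrow> bool" where
  "embedding f P G \<longleftrightarrow> inj_on f (pverts P) \<and> f ` pverts P \<subseteq> pverts G \<and>
     (\<forall>u\<in>pverts P. \<forall>v\<in>pverts P. (u, v) \<in> parcs P \<longleftrightarrow> (f u, f v) \<in> parcs G)"

lemma induced_in_iff_embedding:
  assumes "pair_graph P" "pair_graph G"
  shows "induced_in P G \<longleftrightarrow> (\<exists>f. embedding f P G)"
  unfolding embedding_def by (rule induced_in_iff[OF assms])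

lemma embedding_comp:
  assumes "embedding f P Q" "embedding g Q G"
  shows "embedding (g \<circ> f) P G"
  using assms comp_inj_on[of f "pverts P" g] inj_on_subset[of g "pverts Q" "f ` pverts P"]
  unfolding embedding_def by (auto simp: image_subset_iff)

lemma squarable_embedding:
  assumes "embedding f P G" "pair_graph P" "pair_graph G" "squarable P"
  shows "squarable G"
  using squarable_mono[OF _ assms(2-4)] assms(1) induced_in_iff_embedding[OF assms(2,3)] by blast

text \<open>Rotations reduce the ways in which a vertex can be attached to a cycle to those with a
  prescribed pattern at the indices \<open>m - 1\<close> and \<open>0\<close>.\<close>

lemma rotation_embedding:
  assumes "m > 0"
  shows "embedding (\<lambda>i. (i + r) mod m) (cycle_graph m) (cycle_graph m)"
proof -
  have cong: "(u + r) mod m = (v + r) mod m \<longleftrightarrow> u mod m = v mod m" for u v :: nat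
  proof -
    \<comment> \<open>\<open>nat_mod_eq_iff\<close> expresses congruence as equality after adding
      multiples of \<open>m\<close>; there \<open>r\<close> cancels.\<close>
    have "u + r + a = v + r + b \<longleftrightarrow> u + a = v + b" for a b
      by linarith
    then show ?thesis
      unfolding nat_mod_eq_iff by simp
  qed
  have suc: "Suc ((u + r) mod m) mod m = (Suc u + r) mod m" for u
    by (simp add: mod_Suc_eq)
  have "inj_on (\<lambda>i. (i + r) mod m) {..<m}"
    by (auto simp: inj_on_def cong)
  moreover have "((u + r) mod m, (v + r) mod m) \<in> parcs (cycle_graph m) \<longleftrightarrow>
      (u, v) \<in> parcs (cycle_graph m)" if "u < m" "v < m" for u v
    using that assms cong[of v "Suc u"] cong[of u "Suc v"] by (simp add: cycle_graph_def suc)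
  ultimately show ?thesis
    using assms by (auto simp: embedding_def)
qed

section \<open>Explicit small squarable graphs\<close>

definition edge_graph :: "'a set \<Rightarrow> ('a \<times> 'a) set \<Rightarrow> 'a pair_pre_digraph" where
  "edge_graph V E = \<lparr>pverts = V, parcs = E \<union> E\<inverse>\<rparr>"

lemma pair_graph_edge_graph:
  assumes "finite V" "E \<subseteq> {(u, v). u \<in> V \<and> v \<in> V \<and> u \<noteq> v}"
  shows "pair_graph (edge_graph V E)"
  using assms by (auto simp: pair_graph_iff edge_graph_def sym_def irrefl_def)

lemma card_nbhd_eq_filter:
  assumes "pair_graph G" "pverts G = set vs" "distinct vs"
  shows "card (nbhd G v) = length (filter (\<lambda>u. (v, u) \<in> parcs G) vs)"
proof -
  have "nbhd G v = set (filter (\<lambda>u. (v, u) \<in> parcs G) vs)"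
    using pair_graph_nbhd(2)[OF assms(1), of v] assms(2) by auto
  then show ?thesis
    using distinct_card[of "filter (\<lambda>u. (v, u) \<in> parcs G) vs"] assms(3) by simp
qed

text \<open>Counting degrees along an explicit vertex list lets the simplifier evaluate them.\<close>

lemma squarableI:
  fixes vs E
  defines "Q \<equiv> edge_graph (set vs) E"
  assumes G: "pair_graph G" "pverts G = set vs" "distinct vs"
    and E: "E \<subseteq> {(u, v). u \<in> set vs \<and> v \<in> set vs \<and> u \<noteq> v}"
    and square: "(a, b) \<in> parcs Q" "(b, c) \<in> parcs Q" "(c, d) \<in> parcs Q" "(d, a) \<in> parcs Q"
      "(a, c) \<notin> parcs Q" "(b, d) \<notin> parcs Q" "a \<noteq> c" "b \<noteq> d"
    and deg: "\<forall>v\<in>set vs. length (filter (\<lambda>u. (v, u) \<in> parcs Q) vs) =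
           length (filter (\<lambda>u. (v, u) \<in> parcs G) vs)"
  shows "squarable G"
proof -
  have Q: "pair_graph Q" "pverts Q = set vs"
    using pair_graph_edge_graph[OF _ E] by (simp_all add: Q_def edge_graph_def)
  then have "\<forall>v\<in>set vs. card (nbhd Q v) = card (nbhd G v)"
    using deg by (simp only: card_nbhd_eq_filter[OF Q G(3)] card_nbhd_eq_filter[OF G])
  moreover have "has_square Q"
    using square by (rule has_squareI)
  ultimately show ?thesis
    unfolding squarable_def using G(2) Q by metis
qed

definition cycle_plus_vertex :: "nat \<Rightarrow> nat set \<Rightarrow> nat pair_pre_digraph" where
  "cycle_plus_vertex m N =
     \<lparr>pverts = {..<Suc m}, parcs = parcs (cycle_graph m) \<union> {m} \<times> N \<union> N \<times> {m}\<rparr>"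

lemma pair_graph_cycle_plus_vertex:
  assumes "m \<ge> 3" "N \<subseteq> {..<m}"
  shows "pair_graph (cycle_plus_vertex m N)"
  using pair_graph_cycle_graph[OF assms(1)] assms(2)
  by (auto simp: pair_graph_iff cycle_plus_vertex_def sym_def irrefl_def)

definition cycle_plus_edge :: "nat \<Rightarrow> nat pair_pre_digraph" where
  "cycle_plus_edge m =
     \<lparr>pverts = {..<m + 2}, parcs = parcs (cycle_graph m) \<union> {(m, Suc m), (Suc m, m)}\<rparr>"

lemma pair_graph_cycle_plus_edge:
  assumes "m \<ge> 3"
  shows "pair_graph (cycle_plus_edge m)"
  using pair_graph_cycle_graph[OF assms]
  by (auto simp: pair_graph_iff cycle_plus_edge_def sym_def irrefl_def)

text \<open>
  The witnesses below were found by exhaustive search; the last four arguments of \<open>squarableI\<close> are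
  the vertices of the \<open>C\<^sub>4\<close> in cyclic order.
\<close>

lemma squarable_cycle_plus_edge_5: "squarable (cycle_plus_edge 5)"
  by (rule squarableI[of _ "[0, 1, 2, 3, 4, 5, 6]"
        "{(0, 1), (0, 3), (1, 2), (2, 3), (4, 5), (4, 6)}" 0 1 2 3])
    (simp add: pair_graph_cycle_plus_edge,
     simp_all add: cycle_plus_edge_def cycle_graph_arc_iff edge_graph_def, auto)

lemma squarable_cycle_plus_edge_6: "squarable (cycle_plus_edge 6)"
  by (rule squarableI[of _ "[0, 1, 2, 3, 4, 5, 6, 7]"
        "{(0, 1), (0, 3), (1, 2), (2, 3), (4, 5), (4, 6), (5, 7)}" 0 1 2 3])
    (simp add: pair_graph_cycle_plus_edge,
     simp_all add: cycle_plus_edge_def cycle_graph_arc_iff edge_graph_def, auto)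

text \<open>The new vertex \<open>m\<close> and the cycle vertex \<open>v\<close> are nonadjacent
  and share the nonadjacent neighbours \<open>u\<close> and \<open>w\<close>, so \<open>m\<close>,
  \<open>u\<close>, \<open>v\<close>, \<open>w\<close> span a C4.\<close>

lemma has_square_cycle_plus_vertex:
  assumes "m \<ge> 3" "N \<subseteq> {..<m}" "(u, v) \<in> parcs (cycle_graph m)" "(v, w) \<in> parcs (cycle_graph m)"
    and "u \<noteq> w" "(u, w) \<notin> parcs (cycle_graph m)" "u \<in> N" "w \<in> N" "v \<notin> N"
  shows "has_square (cycle_plus_vertex m N)"
  by (rule has_squareI[of m u _ v w])
    (use assms in \<open>auto simp: cycle_plus_vertex_def cycle_graph_arc_iff\<close>)

text \<open>If a single vertex outside \<open>N\<close> lies between two vertices of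
  \<open>N\<close>, there is a C4 already. Without such a gap few sets \<open>N\<close> remain, and
  each has an explicit rearrangement.\<close>

lemma squarable_cycle_plus_vertex:
  assumes "m = 5 \<or> m = 6" "N \<subseteq> {..<m}" "m - 1 \<in> N" "0 \<notin> N"
  shows "squarable (cycle_plus_vertex m N)"
proof (cases "\<exists>u v w. (u, v) \<in> parcs (cycle_graph m) \<and> (v, w) \<in> parcs (cycle_graph m) \<and>
    u \<noteq> w \<and> (u, w) \<notin> parcs (cycle_graph m) \<and> u \<in> N \<and> w \<in> N \<and> v \<notin> N")
  case True
  then show ?thesis
    using assms has_square_cycle_plus_vertex[of m N]
    by (intro has_square_imp_squarable pair_graph_cycle_plus_vertex) auto
next
  case False
  then have no_gap: "v \<in> N"
    if "(u, v) \<in> parcs (cycle_graph m)" "(v, w) \<in> parcs (cycle_graph m)"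
      "u \<noteq> w" "(u, w) \<notin> parcs (cycle_graph m)" "u \<in> N" "w \<in> N" for u v w
    using that by blast
  \<comment> \<open>Otherwise \<open>0\<close> would be a one-vertex gap between
    \<open>m - 1\<close> and \<open>1\<close>.\<close>
  have 1: "1 \<notin> N"
    using no_gap[of "m - 1" 0 1] assms by (auto simp: cycle_graph_arc_iff)
  show ?thesis
  proof (cases "m = 5")
    case True
    have "i = 2 \<or> i = 3 \<or> i = 4" if "i \<in> N" for i
    proof -
      have "i \<in> {0, 1, 2, 3, 4}"
        using that assms(2) True by auto
      then show ?thesis
        using that 1 assms(4) by auto
    qed
    moreover have "4 \<in> N"
      using assms(3) True by simp
    moreover have "3 \<in> N" if "2 \<in> N"
      using no_gap[of 2 3 4] assms True that by (auto simp: cycle_graph_arc_iff)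
    ultimately have "N = {4} \<or> N = {3, 4} \<or> N = {2, 3, 4}"
      by blast
    note N_cases = this
    have "squarable (cycle_plus_vertex 5 {4})"
      by (rule squarableI[of _ "[0, 1, 2, 3, 4, 5]"
            "{(0, 1), (0, 4), (1, 2), (2, 4), (3, 4), (3, 5)}" 0 1 2 4])
        (simp add: pair_graph_cycle_plus_vertex,
         simp_all add: cycle_plus_vertex_def cycle_graph_arc_iff edge_graph_def, auto)
    moreover have "squarable (cycle_plus_vertex 5 {3, 4})"
      by (rule squarableI[of _ "[0, 1, 2, 3, 4, 5]"
            "{(0, 1), (0, 4), (1, 3), (2, 3), (2, 4), (3, 5), (4, 5)}" 2 3 5 4])
        (simp add: pair_graph_cycle_plus_vertex,
         simp_all add: cycle_plus_vertex_def cycle_graph_arc_iff edge_graph_def, auto)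
    moreover have "squarable (cycle_plus_vertex 5 {2, 3, 4})"
      by (rule squarableI[of _ "[0, 1, 2, 3, 4, 5]"
            "{(0, 2), (0, 4), (1, 2), (1, 3), (2, 5), (3, 4), (3, 5), (4, 5)}" 0 2 5 4])
        (simp add: pair_graph_cycle_plus_vertex,
         simp_all add: cycle_plus_vertex_def cycle_graph_arc_iff edge_graph_def, auto)
    ultimately show ?thesis
      unfolding True using N_cases by metis
  next
    case False
    then have m: "m = 6"
      using assms(1) by simp
    have "i = 2 \<or> i = 3 \<or> i = 4 \<or> i = 5" if "i \<in> N" for i
    proof -
      have "i \<in> {0, 1, 2, 3, 4, 5}"
        using that assms(2) m by auto
      then show ?thesis
        using that 1 assms(4) by auto
    qed
    moreover have "5 \<in> N"
      using assms(3) m by simp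
    moreover have "4 \<in> N" if "3 \<in> N"
      using no_gap[of 3 4 5] assms m that by (auto simp: cycle_graph_arc_iff)
    moreover have "3 \<in> N" if "2 \<in> N" "4 \<in> N"
      using no_gap[of 2 3 4] assms m that by (auto simp: cycle_graph_arc_iff)
    \<comment> \<open>In contrast to the 5-cycle, a set with two separate blocks survives:
      \<open>2\<close> and \<open>5\<close> are opposite, and both gaps between them have two
      vertices.\<close>
    ultimately have "N = {5} \<or> N = {4, 5} \<or> N = {2, 5} \<or> N = {3, 4, 5} \<or> N = {2, 3, 4, 5}"
      by blast
    note N_cases = this
    have "squarable (cycle_plus_vertex 6 {5})"
      by (rule squarableI[of _ "[0, 1, 2, 3, 4, 5, 6]"
            "{(0, 1), (0, 5), (1, 2), (2, 5), (3, 4), (3, 6), (4, 5)}" 0 1 2 5])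
        (simp add: pair_graph_cycle_plus_vertex,
         simp_all add: cycle_plus_vertex_def cycle_graph_arc_iff edge_graph_def, auto)
    moreover have "squarable (cycle_plus_vertex 6 {4, 5})"
      by (rule squarableI[of _ "[0, 1, 2, 3, 4, 5, 6]"
            "{(0, 1), (0, 5), (1, 2), (2, 4), (3, 4), (3, 5), (4, 6), (5, 6)}" 3 4 6 5])
        (simp add: pair_graph_cycle_plus_vertex,
         simp_all add: cycle_plus_vertex_def cycle_graph_arc_iff edge_graph_def, auto)
    moreover have "squarable (cycle_plus_vertex 6 {2, 5})"
      by (rule squarableI[of _ "[0, 1, 2, 3, 4, 5, 6]"
            "{(0, 1), (0, 4), (1, 2), (2, 3), (2, 6), (3, 5), (4, 5), (5, 6)}" 2 3 5 6])
        (simp add: pair_graph_cycle_plus_vertex,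
         simp_all add: cycle_plus_vertex_def cycle_graph_arc_iff edge_graph_def, auto)
    moreover have "squarable (cycle_plus_vertex 6 {3, 4, 5})"
      by (rule squarableI[of _ "[0, 1, 2, 3, 4, 5, 6]"
            "{(0, 1), (0, 5), (1, 3), (2, 3), (2, 4), (3, 6), (4, 5), (4, 6), (5, 6)}" 2 3 6 4])
        (simp add: pair_graph_cycle_plus_vertex,
         simp_all add: cycle_plus_vertex_def cycle_graph_arc_iff edge_graph_def, auto)
    moreover have "squarable (cycle_plus_vertex 6 {2, 3, 4, 5})"
      by (rule squarableI[of _ "[0, 1, 2, 3, 4, 5, 6]"
            "{(0, 1), (0, 5), (1, 6), (2, 3), (2, 4), (2, 6), (3, 4), (3, 6), (4, 5), (5, 6)}" 0 1 6 5])
        (simp add: pair_graph_cycle_plus_vertex,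
         simp_all add: cycle_plus_vertex_def cycle_graph_arc_iff edge_graph_def, auto)
    ultimately show ?thesis
      unfolding m using N_cases by metis
  qed
qed

text \<open>The inner vertices have degree 2 and the ends degree 1, so a C4 on the former together
  with an edge joining the latter has the same degrees.\<close>

lemma squarable_path_6: "squarable (edge_graph {..<6} {(u, v). v = Suc u \<and> v < 6})"
  by (rule squarableI[of _ "[0, 1, 2, 3, 4, 5]" "{(1, 2), (2, 3), (3, 4), (4, 1), (0, 5)}" 1 2 3 4])
    (rule pair_graph_edge_graph, simp, force, simp_all add: edge_graph_def, auto)

section \<open>Structure around an induced cycle\<close>

lemma squarable_long_cycle:
  assumes "pair_graph G" "m \<ge> 7" "embedding c (cycle_graph m) G"
  shows "squarable G"
proof -
  let ?P = "edge_graph {..<6} {(u, v). v = Suc u \<and> v < (6 :: nat)}"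
  \<comment> \<open>The vertices \<open>0\<close> to \<open>5\<close> induce a path because
    \<open>m \<ge> 7\<close>; in C6 the ends \<open>0\<close> and \<open>5\<close> would be
    adjacent.\<close>
  have emb: "embedding id ?P (cycle_graph m)"
    using assms(2) by (auto simp: embedding_def edge_graph_def cycle_graph_arc_iff)
  have cyc: "pair_graph (cycle_graph m)"
    using assms(2) by (simp add: pair_graph_cycle_graph)
  have "pair_graph ?P"
    by (rule pair_graph_edge_graph) auto
  then have "squarable (cycle_graph m)"
    using squarable_embedding[OF emb] cyc squarable_path_6 by blast
  then show ?thesis
    using squarable_embedding[OF assms(3) cyc assms(1)] by blast
qed

text \<open>This transfers the attachment of \<open>v\<close> to the cycle into the model graph, for
  which explicit rearrangements are available.\<close>

lemma embedding_cycle_plus_vertex: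
  assumes G: "pair_graph G" and c: "embedding c (cycle_graph m) G"
    and v: "v \<in> pverts G" "v \<notin> c ` {..<m}"
  shows "embedding (c(m := v)) (cycle_plus_vertex m {i. i < m \<and> c i \<in> nbhd G v}) G"
    (is "embedding ?f (cycle_plus_vertex m ?N) G")
  unfolding embedding_def
proof (intro conjI ballI)
  have cv: "c i \<noteq> v" if "i < m" for i
    using v(2) that by blast
  have sym: "(x, y) \<in> parcs G \<longleftrightarrow> (y, x) \<in> parcs G" for x y
    using pair_graph_nbhd(4)[OF G, of y x] by simp
  have irr: "(x, x) \<notin> parcs G" for x
    using pair_graph_nbhd(3)[OF G, of x] by simp
  have "inj_on c {..<m}"
    using c by (simp add: embedding_def)
  then show "inj_on ?f (pverts (cycle_plus_vertex m ?N))"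
    by (auto simp: cycle_plus_vertex_def inj_on_def less_Suc_eq cv cv[symmetric])
  show "?f ` pverts (cycle_plus_vertex m ?N) \<subseteq> pverts G"
    using c v(1) by (auto simp: cycle_plus_vertex_def embedding_def less_Suc_eq)
  fix x y assume xy: "x \<in> pverts (cycle_plus_vertex m ?N)" "y \<in> pverts (cycle_plus_vertex m ?N)"
  have old: "(c x, c y) \<in> parcs G \<longleftrightarrow> (x, y) \<in> parcs (cycle_graph m)" if "x < m" "y < m"
    using that c by (simp add: embedding_def)
  consider "x < m" "y < m" | "x = m" "y < m" | "x < m" "y = m" | "x = m" "y = m"
    using xy by (auto simp: cycle_plus_vertex_def less_Suc_eq)
  then show "(x, y) \<in> parcs (cycle_plus_vertex m ?N) \<longleftrightarrow> (?f x, ?f y) \<in> parcs G"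
  proof cases
    case 1
    then show ?thesis by (simp add: old cycle_plus_vertex_def)
  next
    case 2
    then show ?thesis by (auto simp: cycle_plus_vertex_def cycle_graph_arc_iff)
  next
    case 3
    then show ?thesis by (auto simp: cycle_plus_vertex_def cycle_graph_arc_iff sym)
  next
    case 4
    then show ?thesis by (auto simp: cycle_plus_vertex_def cycle_graph_arc_iff irr)
  qed
qed

lemma embedding_cycle_plus_edge:
  assumes G: "pair_graph G" and c: "embedding c (cycle_graph m) G"
    and uv: "(u, v) \<in> parcs G" "u \<notin> c ` {..<m}" "v \<notin> c ` {..<m}"
    and anti: "c ` {..<m} \<inter> nbhd G u = {}" "c ` {..<m} \<inter> nbhd G v = {}"
  shows "embedding (c(m := u, Suc m := v)) (cycle_plus_edge m) G"
    (is "embedding ?f ?P G")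
  unfolding embedding_def
proof (intro conjI ballI)
  have sym: "(x, y) \<in> parcs G \<longleftrightarrow> (y, x) \<in> parcs G" for x y
    using pair_graph_nbhd(4)[OF G, of y x] by simp
  have irr: "(x, x) \<notin> parcs G" for x
    using pair_graph_nbhd(3)[OF G, of x] by simp
  have vu: "(v, u) \<in> parcs G" and "u \<noteq> v"
    using uv(1) sym irr by auto
  have mem: "u \<in> pverts G" "v \<in> pverts G"
    using uv(1) vu pair_graph_nbhd(2)[OF G] by blast+
  have inj: "inj_on c {..<m}"
    and cc: "\<And>i j. i < m \<Longrightarrow> j < m \<Longrightarrow> (c i, c j) \<in> parcs G \<longleftrightarrow> (i, j) \<in> parcs (cycle_graph m)"
    using c by (auto simp: embedding_def)
  have cu: "c i \<noteq> u" "c i \<noteq> v" "(u, c i) \<notin> parcs G" "(v, c i) \<notin> parcs G"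
    "(c i, u) \<notin> parcs G" "(c i, v) \<notin> parcs G" if "i < m" for i
    using uv(2,3) anti that sym by auto
  show "inj_on ?f (pverts ?P)"
    using inj \<open>u \<noteq> v\<close>
    by (auto simp: cycle_plus_edge_def inj_on_def less_Suc_eq cu cu(1,2)[symmetric])
  show "?f ` pverts ?P \<subseteq> pverts G"
    using c mem by (auto simp: cycle_plus_edge_def embedding_def less_Suc_eq)
  fix x y assume "x \<in> pverts ?P" "y \<in> pverts ?P"
  then have "x < m \<or> x = m \<or> x = Suc m" "y < m \<or> y = m \<or> y = Suc m"
    by (auto simp: cycle_plus_edge_def)
  then show "(x, y) \<in> parcs ?P \<longleftrightarrow> (?f x, ?f y) \<in> parcs G"
    by (elim disjE) (simp_all add: cycle_plus_edge_def cc cu uv(1) vu irr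
        cycle_graph_arc_iff[of m] cycle_graph_arc_iff[of _ m]
        cycle_graph_arc_iff[of "Suc m"] cycle_graph_arc_iff[of _ "Suc m"])
qed

text \<open>Going once around the cycle, a vertex with both neighbours and non-neighbours on it must
  pass from a neighbour to a non-neighbour in one step. Rotating the cycle to that place leads to
  \<open>squarable_cycle_plus_vertex\<close>.\<close>

lemma complete_or_anticomplete_to_cycle:
  assumes G: "pair_graph G" "\<not> squarable G" and m: "m = 5 \<or> m = 6"
    and c: "embedding c (cycle_graph m) G" and v: "v \<in> pverts G" "v \<notin> c ` {..<m}"
  shows "c ` {..<m} \<subseteq> nbhd G v \<or> c ` {..<m} \<inter> nbhd G v = {}"
proof (rule ccontr)
  assume *: "\<not> ?thesis"
  have m3: "m \<ge> 3" using m by auto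
  obtain r where r: "r < m" "c r \<in> nbhd G v" "c (Suc r mod m) \<notin> nbhd G v"
  proof (rule ccontr)
    assume no: "\<not> thesis"
    obtain i j where i: "i < m" "c i \<in> nbhd G v" and j: "j < m" "c j \<notin> nbhd G v"
      using * by blast
    \<comment> \<open>If adjacency to \<open>v\<close> never broke off from one cycle vertex to the
      next, it would spread from \<open>c i\<close> to the whole cycle.\<close>
    have "c ((i + n) mod m) \<in> nbhd G v" for n
    proof (induction n)
      case 0
      then show ?case using i by simp
    next
      case (Suc n)
      have "Suc ((i + n) mod m) mod m = (i + Suc n) mod m"
        by (simp add: mod_Suc_eq)
      then show ?case
        using Suc no that[of "(i + n) mod m"] m3 by fastforce
    qed
    \<comment> \<open>Going \<open>m - i + j\<close> steps from \<open>i\<close> ends at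
      \<open>j\<close> modulo \<open>m\<close>; the added \<open>m\<close> avoids truncation when
      \<open>j < i\<close>.\<close>
    from this[of "m - i + j"] show False
      using i j by simp
  qed
  \<comment> \<open>Rotate the cycle so that \<open>v\<close> is adjacent to its last vertex but not to its first.\<close>
  define s where "s = Suc r mod m"
  define c' where "c' = c \<circ> (\<lambda>i. (i + s) mod m)"
  have emb: "embedding c' (cycle_graph m) G"
    unfolding c'_def using embedding_comp[OF rotation_embedding c] m3 by simp
  have c'0: "c' 0 = c s"
    using m3 by (simp add: c'_def s_def)
  have "(m - 1 + s) mod m = (m - 1 + Suc r) mod m"
    unfolding s_def by (simp add: mod_add_right_eq)
  also have "\<dots> = r"
    using r m3 by simp
  finally have c'1: "c' (m - 1) = c r"
    by (simp add: c'_def)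
  define N where "N = {i. i < m \<and> c' i \<in> nbhd G v}"
  have "v \<notin> c' ` {..<m}"
    using v(2) m3 by (auto simp: c'_def)
  then have "embedding (c'(m := v)) (cycle_plus_vertex m N) G"
    unfolding N_def by (rule embedding_cycle_plus_vertex[OF G(1) emb v(1)])
  moreover have "N \<subseteq> {..<m}" "m - 1 \<in> N" "0 \<notin> N"
    using m3 r c'0 c'1 unfolding N_def s_def by (simp_all add: Collect_restrict subset_eq)
  ultimately show False
    using squarable_embedding squarable_cycle_plus_vertex[OF m] pair_graph_cycle_plus_vertex[OF m3] G
    by blast
qed

text \<open>\<open>G\<close> is isomorphic to the composed graph, with \<open>S\<close> its subgraph
  induced by the vertices off the cycle; the conclusion records the resulting equality of degree
  sequences. As an induced subgraph, \<open>S\<close> has the vertex type of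
  \<open>G\<close>.\<close>

lemma not_squarable_imp_split_compose:
  fixes G :: "'a pair_pre_digraph"
  assumes G: "pair_graph G" "\<not> squarable G" and m: "m = 5 \<or> m = 6"
    and c: "embedding c (cycle_graph m) G"
  shows "\<exists>(S :: 'a pair_pre_digraph) A B. split_graph S \<and> split_partition S A B \<and>
    degree_sequence G = degree_sequence (split_compose S A B (cycle_graph m))"
proof -
  have m3: "m \<ge> 3" using m by auto
  define H where "H = c ` {..<m}"
  define A where "A = {v \<in> pverts G - H. H \<subseteq> nbhd G v}"
  define B where "B = {v \<in> pverts G - H. H \<inter> nbhd G v = {}}"
  define S where "S = \<lparr>pverts = A \<union> B, parcs = parcs G \<inter> (A \<union> B) \<times> (A \<union> B)\<rparr>"
  have sym: "(x, y) \<in> parcs G \<longleftrightarrow> (y, x) \<in> parcs G" for x y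
    using pair_graph_nbhd(4)[OF G(1), of y x] by simp
  have nosq: "\<not> has_square G"
    using G has_square_imp_squarable by blast
  have inj: "inj_on c {..<m}" and HG: "H \<subseteq> pverts G"
    and cc: "\<And>i j. i < m \<Longrightarrow> j < m \<Longrightarrow> (c i, c j) \<in> parcs G \<longleftrightarrow> (i, j) \<in> parcs (cycle_graph m)"
    using c by (auto simp: embedding_def H_def)
  have AB: "A \<union> B = pverts G - H"
    using complete_or_anticomplete_to_cycle[OF G m c] by (auto simp: A_def B_def H_def)
  \<comment> \<open>A vertex off the cycle cannot be both complete and anticomplete to it because
    the cycle is nonempty.\<close>
  have "c 0 \<in> H"
    using m3 by (simp add: H_def)
  then have disj: "A \<inter> B = {}"
    unfolding A_def B_def by blast
  have "complete_set S A"
    unfolding complete_set_def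
  proof (intro ballI impI)
    fix u v assume uv: "u \<in> A" "v \<in> A" "u \<noteq> v"
    \<comment> \<open>Indices \<open>0\<close> and \<open>2\<close> are nonadjacent in C5 and C6, so
      two nonadjacent vertices of \<open>A\<close> would form a C4 with them.\<close>
    have "c 0 \<in> H" "c 2 \<in> H"
      using m3 by (auto simp: H_def)
    then have arcs: "(u, c 0) \<in> parcs G" "(c 0, v) \<in> parcs G" "(v, c 2) \<in> parcs G" "(c 2, u) \<in> parcs G"
      using uv sym by (auto simp: A_def)
    have "(c 0, c 2) \<notin> parcs G" "c 0 \<noteq> c 2"
      using m cc[of 0 2] inj_on_eq_iff[OF inj, of 0 2] by (auto simp: cycle_graph_arc_iff)
    then have "(u, v) \<in> parcs G"
      using has_squareI[OF arcs] uv nosq by blast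
    then show "(u, v) \<in> parcs S"
      using uv by (simp add: S_def)
  qed
  moreover have "anticomplete_set S B"
    unfolding anticomplete_set_def
  proof (intro ballI impI notI)
    fix u v assume uv: "u \<in> B" "v \<in> B" "u \<noteq> v" "(u, v) \<in> parcs S"
    then have "embedding (c(m := u, Suc m := v)) (cycle_plus_edge m) G"
      by (intro embedding_cycle_plus_edge[OF G(1) c]) (auto simp: B_def H_def S_def)
    moreover have "squarable (cycle_plus_edge m)"
      using m squarable_cycle_plus_edge_5 squarable_cycle_plus_edge_6 by auto
    ultimately show False
      using squarable_embedding pair_graph_cycle_plus_edge[OF m3] G by blast
  qed
  ultimately have part: "split_partition S A B"
    using disj by (simp add: split_partition_def S_def)
  have S: "pair_graph S"
    using G(1) AB finite_subset[of "A \<union> B" "pverts G"] by (auto simp: pair_graph_iff S_def sym_def irrefl_def)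
  define X where "X = split_compose S A B (cycle_graph m)"
  \<comment> \<open>This is the isomorphism from \<open>X\<close> to \<open>G\<close>: the identity
    on \<open>S\<close> and \<open>c\<close> on the cycle.\<close>
  define g where "g = case_sum id c"
  have XV: "pverts X = (A \<union> B) <+> {..<m}"
    by (simp add: X_def split_compose_def S_def)
  have X: "pair_graph X"
    unfolding X_def using S part pair_graph_cycle_graph[OF m3] by (rule pair_graph_split_compose)
  have bij: "bij_betw g (pverts X) (pverts G)"
  proof -
    have "c i \<notin> A \<union> B" if "i < m" for i
      using that AB by (auto simp: H_def)
    then have "inj_on g (pverts X)"
      using inj by (auto simp: XV g_def inj_on_def Plus_def)
    moreover have "g ` pverts X = pverts G"
      using AB HG by (auto simp: XV g_def Plus_def image_Un image_image H_def)
    ultimately show ?thesis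
      by (simp add: bij_betw_def)
  qed
  have arcs: "(g x, g y) \<in> parcs G \<longleftrightarrow> (x, y) \<in> parcs X" if "x \<in> pverts X" "y \<in> pverts X" for x y
  proof -
    have mixed: "(u, c i) \<in> parcs G \<longleftrightarrow> u \<in> A" "(c i, u) \<in> parcs G \<longleftrightarrow> u \<in> A"
      if "u \<in> A \<union> B" "i < m" for u i
      using that disj sym by (auto simp: A_def B_def H_def)
    show ?thesis
      using that by (auto simp: XV X_def g_def split_compose_def S_def mixed cc)
  qed
  have "card (nbhd G (g x)) = card (nbhd X x)" if x: "x \<in> pverts X" for x
  proof -
    have "nbhd G (g x) = g ` nbhd X x"
    proof (intro equalityI subsetI)
      fix z assume z: "z \<in> nbhd G (g x)"
      then have "z \<in> pverts G"
        using pair_graph_nbhd(2)[OF G(1)] by blast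
      then obtain y where "y \<in> pverts X" "z = g y"
        using bij by (auto simp: bij_betw_def)
      then show "z \<in> g ` nbhd X x"
        using z arcs x by auto
    next
      fix z assume "z \<in> g ` nbhd X x"
      then show "z \<in> nbhd G (g x)"
        using arcs x pair_graph_nbhd(2)[OF X, of x] by auto
    qed
    moreover have "inj_on g (nbhd X x)"
      using bij pair_graph_nbhd(2)[OF X, of x] by (auto simp: bij_betw_def intro: inj_on_subset)
    ultimately show ?thesis
      by (simp add: card_image)
  qed
  then have "degree_sequence X = degree_sequence G"
    using degree_sequence_eqI[OF bij] by blast
  then show ?thesis
    using S part unfolding X_def split_graph_def by metis
qed

section \<open>Recognizing split compositions from degree sums\<close>

text \<open>
  When \<open>A\<close>, \<open>B\<close>, \<open>H\<close> partition the vertices, \<open>blow_up G A B H\<close> says that \<open>G\<close> is \<open>(S,A,B) \<circ> G[H]\<close> for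
  \<open>S = G[A \<union> B]\<close>.
\<close>

definition blow_up :: "'a pair_pre_digraph \<Rightarrow> 'a set \<Rightarrow> 'a set \<Rightarrow> 'a set \<Rightarrow> bool" where
  "blow_up G A B H \<longleftrightarrow>
     (\<forall>u\<in>A. A \<union> H - {u} \<subseteq> nbhd G u) \<and> (\<forall>w\<in>B. nbhd G w \<subseteq> A)"

text \<open>Counting the arcs between \<open>A\<close> and \<open>B\<close> from either end writes
  the degree sum over \<open>A\<close> as the sum of \<open>f\<close> over \<open>A\<close> plus the
  sum of \<open>g\<close> over \<open>B\<close>. Termwise \<open>f u \<le> k\<close> and
  \<open>g w\<close> is at most the degree of \<open>w\<close>; equality everywhere is exactly
  \<open>blow_up\<close>. The criterion involves only degrees and set sizes, so it passes to other
  realizations.\<close>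

lemma blow_up_iff_degree_sums:
  assumes G: "pair_graph G" and V: "pverts G = A \<union> B \<union> H"
    and disj: "A \<inter> B = {}" "A \<inter> H = {}" "B \<inter> H = {}"
  shows "blow_up G A B H \<longleftrightarrow>
    (\<Sum>u\<in>A. card (nbhd G u)) = card A * (card A + card H - 1) + (\<Sum>w\<in>B. card (nbhd G w))"
proof -
  have fin: "finite A" "finite B" "finite H"
    using G V by (auto simp: pair_graph_iff)
  note finN = pair_graph_nbhd(1)[OF G]
  define f where "f u = card (nbhd G u \<inter> (A \<union> H))" for u
  define g where "g w = card (nbhd G w \<inter> A)" for w
  \<comment> \<open>The subtraction truncates only if \<open>A\<close> and \<open>H\<close> are both
    empty, and then the factor \<open>card A\<close> is 0.\<close>
  define k where "k = card A + card H - 1"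
  have kcard: "card (A \<union> H - {u}) = k" if "u \<in> A" for u
    using that fin disj by (simp add: k_def card_Un_disjoint)
  have fsub: "nbhd G u \<inter> (A \<union> H) \<subseteq> A \<union> H - {u}" for u
    using pair_graph_nbhd(3)[OF G, of u] by blast
  have fle: "f u \<le> k" if "u \<in> A" for u
    using card_mono[OF _ fsub[of u]] fin kcard[OF that] by (simp add: f_def)
  have feq: "f u = k \<longleftrightarrow> A \<union> H - {u} \<subseteq> nbhd G u" if "u \<in> A" for u
  proof
    assume "f u = k"
    then have "nbhd G u \<inter> (A \<union> H) = A \<union> H - {u}"
      using card_subset_eq[OF _ fsub[of u]] fin kcard[OF that] by (simp add: f_def)
    then show "A \<union> H - {u} \<subseteq> nbhd G u" by blast
  next
    assume "A \<union> H - {u} \<subseteq> nbhd G u"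
    then have "nbhd G u \<inter> (A \<union> H) = A \<union> H - {u}"
      using fsub[of u] by blast
    then show "f u = k"
      using kcard[OF that] by (simp add: f_def)
  qed
  have gle: "g w \<le> card (nbhd G w)" for w
    by (simp add: g_def card_mono finN)
  have geq: "g w = card (nbhd G w) \<longleftrightarrow> nbhd G w \<subseteq> A" for w
    using card_subset_eq[OF finN[of w], of "nbhd G w \<inter> A"] by (auto simp: g_def Int_absorb2)
  have "card (nbhd G u) = f u + card (nbhd G u \<inter> B)" for u
  proof -
    have "nbhd G u = (nbhd G u \<inter> (A \<union> H)) \<union> (nbhd G u \<inter> B)"
      using pair_graph_nbhd(2)[OF G, of u] V by blast
    then have "card (nbhd G u) = card ((nbhd G u \<inter> (A \<union> H)) \<union> (nbhd G u \<inter> B))"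
      by simp
    also have "\<dots> = f u + card (nbhd G u \<inter> B)"
      unfolding f_def using disj finN by (intro card_Un_disjoint) auto
    finally show ?thesis .
  qed
  then have "(\<Sum>u\<in>A. card (nbhd G u)) = (\<Sum>u\<in>A. f u) + (\<Sum>u\<in>A. card (nbhd G u \<inter> B))"
    by (simp add: sum.distrib)
  \<comment> \<open>Double counting: each size becomes a sum of indicators, and the order of
    summation is exchanged.\<close>
  also have "(\<Sum>u\<in>A. card (nbhd G u \<inter> B)) = (\<Sum>w\<in>B. g w)"
  proof -
    have ind: "card (nbhd G u \<inter> Y) = (\<Sum>w\<in>Y. if (u, w) \<in> parcs G then 1 else 0)" if "finite Y" for u Y
      using that by (simp add: sum.If_cases Int_def conj_commute)
    have "(\<Sum>u\<in>A. card (nbhd G u \<inter> B)) = (\<Sum>w\<in>B. \<Sum>u\<in>A. if (u, w) \<in> parcs G then 1 else 0)"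
      unfolding ind[OF fin(2)] by (rule sum.swap)
    also have "\<dots> = (\<Sum>w\<in>B. g w)"
    proof (rule sum.cong)
      fix w assume "w \<in> B"
      show "(\<Sum>u\<in>A. if (u, w) \<in> parcs G then 1 else 0) = g w"
        unfolding g_def ind[OF fin(1)] using pair_graph_nbhd(4)[OF G, of w] by simp
    qed simp
    finally show ?thesis .
  qed
  finally have sumA: "(\<Sum>u\<in>A. card (nbhd G u)) = (\<Sum>u\<in>A. f u) + (\<Sum>w\<in>B. g w)" .
  have 1: "(\<Sum>u\<in>A. f u) \<le> (\<Sum>u\<in>A. k)"
    using fle by (rule sum_mono)
  have 2: "(\<Sum>w\<in>B. g w) \<le> (\<Sum>w\<in>B. card (nbhd G w))"
    using gle by (rule sum_mono)
  \<comment> \<open>Both parts are bounded above by \<open>1\<close> and \<open>2\<close>, so their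
    total attains the sum of the bounds only if each part attains its own.\<close>
  have "(\<Sum>u\<in>A. card (nbhd G u)) = card A * k + (\<Sum>w\<in>B. card (nbhd G w)) \<longleftrightarrow>
      (\<Sum>u\<in>A. f u) = (\<Sum>u\<in>A. k) \<and> (\<Sum>w\<in>B. g w) = (\<Sum>w\<in>B. card (nbhd G w))"
    unfolding sumA using 1 2 by auto
  also have "\<dots> \<longleftrightarrow> (\<forall>u\<in>A. f u = k) \<and> (\<forall>w\<in>B. g w = card (nbhd G w))"
    using sum_mono_inv[of f A "\<lambda>_. k"] sum_mono_inv[of g B "\<lambda>w. card (nbhd G w)"] fle gle fin
    by (metis (no_types, lifting) sum.cong)
  also have "\<dots> \<longleftrightarrow> blow_up G A B H"
    by (simp add: blow_up_def feq geq)
  finally show ?thesis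
    by (simp add: k_def)
qed

text \<open>A vertex of \<open>H\<close> sees all of \<open>A\<close> and nothing of
  \<open>B\<close>. Hence its degree in \<open>G\<close> determines its degree inside
  \<open>H\<close>.\<close>

lemma blow_up_card_nbhd:
  assumes G: "pair_graph G" and V: "pverts G = A \<union> B \<union> H"
    and disj: "A \<inter> B = {}" "A \<inter> H = {}" "B \<inter> H = {}"
    and bu: "blow_up G A B H" and h: "h \<in> H"
  shows "card (nbhd G h) = card A + card (nbhd G h \<inter> H)"
proof -
  have "A \<subseteq> nbhd G h"
    using bu h disj pair_graph_nbhd(4)[OF G, of h] by (fastforce simp: blow_up_def)
  moreover have "B \<inter> nbhd G h = {}"
    using bu h disj pair_graph_nbhd(4)[OF G, of h] by (fastforce simp: blow_up_def)
  ultimately have "nbhd G h = A \<union> (nbhd G h \<inter> H)"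
    using pair_graph_nbhd(2)[OF G, of h] V by blast
  then have "card (nbhd G h) = card (A \<union> (nbhd G h \<inter> H))"
    by simp
  also have "\<dots> = card A + card (nbhd G h \<inter> H)"
    using G V disj pair_graph_nbhd(1)[OF G] by (intro card_Un_disjoint) (auto simp: pair_graph_iff)
  finally show ?thesis .
qed

text \<open>A C4 would have to lie inside \<open>H\<close> and, by 2-regularity, be cut off from the
  rest of \<open>H\<close>. That rest has one or two vertices, too few for a vertex of degree
  2.\<close>

lemma blow_up_not_has_square:
  assumes G: "pair_graph G" and V: "pverts G = A \<union> B \<union> H"
    and disj: "A \<inter> B = {}" "A \<inter> H = {}" "B \<inter> H = {}"
    and bu: "blow_up G A B H" and reg: "\<forall>h\<in>H. card (nbhd G h \<inter> H) = 2"
    and H: "card H = 5 \<or> card H = 6"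
  shows "\<not> has_square G"
proof
  assume "has_square G"
  then obtain a b c d where sq: "a \<noteq> c" "b \<noteq> d"
    "(a, b) \<in> parcs G" "(b, c) \<in> parcs G" "(c, d) \<in> parcs G" "(d, a) \<in> parcs G"
    "(a, c) \<notin> parcs G" "(b, d) \<notin> parcs G"
    unfolding has_square_def by blast
  have sym: "(x, y) \<in> parcs G \<longleftrightarrow> (y, x) \<in> parcs G" for x y
    using pair_graph_nbhd(4)[OF G, of y x] by simp
  have irr: "(x, x) \<notin> parcs G" for x
    using pair_graph_nbhd(3)[OF G, of x] by simp
  \<comment> \<open>Each vertex of a C4 has two nonadjacent neighbours, whereas neighbours of a
    vertex of \<open>B\<close> lie in the complete set \<open>A\<close>; so no vertex is in
    \<open>B\<close>. A vertex \<open>x\<close> in \<open>A\<close> would then be adjacent to the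
    opposite vertex \<open>z\<close>, which lies in \<open>A \<union> H\<close>.\<close>
  have in_H: "x \<in> H" if "x \<noteq> z" "y \<noteq> w" "(x, y) \<in> parcs G" "(y, z) \<in> parcs G" "(z, w) \<in> parcs G"
    "(w, x) \<in> parcs G" "(x, z) \<notin> parcs G" "(y, w) \<notin> parcs G" for x y z w
  proof -
    have notB: "p \<notin> B" if "(p, q) \<in> parcs G" "(p, r) \<in> parcs G" "q \<noteq> r" "(q, r) \<notin> parcs G" for p q r
    proof
      assume "p \<in> B"
      then have "q \<in> A" "r \<in> A"
        using bu that(1,2) unfolding blow_up_def by blast+
      moreover from this have "A \<union> H - {q} \<subseteq> nbhd G q"
        using bu by (simp add: blow_up_def)
      ultimately have "r \<in> nbhd G q"
        using that(3) by blast
      then show False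
        using that(4) by simp
    qed
    have "x \<notin> B" "z \<notin> B"
      using notB[of x y w] notB[of z w y] that sym by blast+
    moreover have "z \<in> pverts G" "x \<in> pverts G"
      using that pair_graph_nbhd(2)[OF G] by blast+
    moreover have "x \<notin> A" if "z \<in> A \<union> H"
    proof
      assume "x \<in> A"
      then have "A \<union> H - {x} \<subseteq> nbhd G x"
        using bu by (simp add: blow_up_def)
      then show False
        using that \<open>x \<noteq> z\<close> \<open>(x, z) \<notin> parcs G\<close> by blast
    qed
    ultimately show ?thesis
      using V by blast
  qed
  have abcd: "a \<in> H" "b \<in> H" "c \<in> H" "d \<in> H"
    using in_H[of a c b d] in_H[of b d c a] in_H[of c a d b] in_H[of d b a c] sq sym by metis+
  have nb: "nbhd G x \<inter> H = {y, z}"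
    if "x \<in> H" "y \<in> H" "z \<in> H" "y \<noteq> z" "(x, y) \<in> parcs G" "(x, z) \<in> parcs G" for x y z
    using that reg card_subset_eq[of "nbhd G x \<inter> H" "{y, z}"] pair_graph_nbhd(1)[OF G] by auto
  have N: "nbhd G a \<inter> H = {b, d}" "nbhd G b \<inter> H = {a, c}" "nbhd G c \<inter> H = {b, d}"
    "nbhd G d \<inter> H = {a, c}"
    by (intro nb; use abcd sq sym in simp)+
  have "a \<noteq> b" "b \<noteq> c" "c \<noteq> d" "d \<noteq> a"
    using sq irr by blast+
  then have dist: "card {a, b, c, d} = 4"
    using sq by simp
  have finH: "finite H"
    using H card.infinite by fastforce
  then have R: "card (H - {a, b, c, d}) = card H - 4"
    using dist abcd by (subst card_Diff_subset) auto
  then have "card (H - {a, b, c, d}) \<noteq> 0"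
    using H by arith
  then have "H - {a, b, c, d} \<noteq> {}"
    by (metis card.empty)
  then obtain e where e: "e \<in> H" "e \<notin> {a, b, c, d}"
    by blast
  \<comment> \<open>The vertices of the C4 already have both their neighbours in \<open>H\<close> on
    the C4, so none is adjacent to \<open>e\<close>.\<close>
  have "nbhd G e \<inter> H \<subseteq> H - {a, b, c, d} - {e}"
  proof
    fix x assume x: "x \<in> nbhd G e \<inter> H"
    then have "e \<in> nbhd G x \<inter> H"
      using e(1) sym by simp
    then have "x \<notin> {a, b, c, d}"
      using N e(2) by auto
    then show "x \<in> H - {a, b, c, d} - {e}"
      using x irr by auto
  qed
  then have "card (nbhd G e \<inter> H) \<le> card (H - {a, b, c, d} - {e})"
    using finH by (intro card_mono) auto
  also have "\<dots> \<le> 1"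
    using R e finH H by auto
  finally show False
    using reg e by auto
qed

lemma split_compose_blow_up:
  assumes "pair_graph S" "split_partition S A B"
  shows "blow_up (split_compose S A B H) (Inl ` A) (Inl ` B) (Inr ` pverts H)"
proof -
  have "nbhd S w \<subseteq> A" if "w \<in> B" for w
  proof
    fix x assume x: "x \<in> nbhd S w"
    then have "x \<in> A \<union> B" "w \<noteq> x"
      using assms(2) pair_graph_nbhd(2,3)[OF assms(1), of w] by (auto simp: split_partition_def)
    moreover have "x \<notin> B"
      using x that assms(2) \<open>w \<noteq> x\<close> by (auto simp: split_partition_def anticomplete_set_def)
    ultimately show "x \<in> A"
      by blast
  qed
  then show ?thesis
    using assms(2)
    by (auto simp: blow_up_def split_compose_def split_partition_def complete_set_def)
qed

text \<open>A degree-preserving bijection \<open>p\<close> from the composed graph carries its three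
  vertex classes to \<open>G\<close>. Although \<open>p\<close> need not preserve arcs, the
  criterion of \<open>blow_up_iff_degree_sums\<close> survives, and with it the structure that
  forbids a C4.\<close>

lemma not_has_square_of_split_compose:
  fixes G :: "'a pair_pre_digraph"
  assumes S: "split_graph S" "split_partition S A B" and m: "m = 5 \<or> m = 6"
    and G: "pair_graph G" "degree_sequence G = degree_sequence (split_compose S A B (cycle_graph m))"
  shows "\<not> has_square G"
proof -
  define X where "X = split_compose S A B (cycle_graph m)"
  have m3: "m \<ge> 3" using m by auto
  have X: "pair_graph X"
    unfolding X_def using S pair_graph_cycle_graph[OF m3]
    by (intro pair_graph_split_compose) (auto simp: split_graph_def)
  have XV: "pverts X = Inl ` A \<union> Inl ` B \<union> Inr ` {..<m}"
    using S(2) by (auto simp: X_def split_compose_def split_partition_def)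
  have Xdisj: "Inl ` A \<inter> Inl ` B = {}" "Inl ` A \<inter> Inr ` {..<m} = {}" "Inl ` B \<inter> Inr ` {..<m} = {}"
    using S(2) by (auto simp: split_partition_def)
  have Xbu: "blow_up X (Inl ` A) (Inl ` B) (Inr ` {..<m})"
    using split_compose_blow_up[OF _ S(2), of "cycle_graph m"] S(1)
    by (simp add: X_def split_graph_def)
  obtain p where p: "bij_betw p (pverts X) (pverts G)"
    and deg: "\<And>v. v \<in> pverts X \<Longrightarrow> card (nbhd G (p v)) = card (nbhd X v)"
    using degree_sequence_eqE[of X G] G X by (auto simp: X_def pair_graph_iff)
  have inj: "inj_on p (pverts X)"
    using p by (simp add: bij_betw_def)
  define A' B' H' where "A' = p ` Inl ` A" and "B' = p ` Inl ` B" and "H' = p ` Inr ` {..<m}"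
  have GV: "pverts G = A' \<union> B' \<union> H'"
    using p by (simp add: A'_def B'_def H'_def bij_betw_def XV image_Un)
  have Gdisj: "A' \<inter> B' = {}" "A' \<inter> H' = {}" "B' \<inter> H' = {}"
    using inj Xdisj unfolding A'_def B'_def H'_def
    by (subst inj_on_image_Int[OF inj, symmetric]; auto simp: XV)+
  have cards: "card (p ` Y) = card Y" "(\<Sum>u\<in>p ` Y. card (nbhd G u)) = (\<Sum>u\<in>Y. card (nbhd X u))"
    if "Y \<subseteq> pverts X" for Y
    using that inj_on_subset[OF inj that] deg by (auto simp: card_image sum.reindex intro!: sum.cong)
  have Gbu: "blow_up G A' B' H'"
    using Xbu unfolding blow_up_iff_degree_sums[OF X XV Xdisj] blow_up_iff_degree_sums[OF G(1) GV Gdisj]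
    unfolding A'_def B'_def H'_def by (simp add: cards XV le_supI1)
  have "card (nbhd X (Inr i) \<inter> Inr ` {..<m}) = 2" if "i < m" for i
  proof -
    have "nbhd X (Inr i) \<inter> Inr ` {..<m} = Inr ` nbhd (cycle_graph m) i"
      by (auto simp: X_def split_compose_def cycle_graph_arc_iff)
    then show ?thesis
      using card_nbhd_cycle_graph[OF m3 that] by (simp add: card_image)
  qed
  moreover have "Inl ` A \<subseteq> pverts X"
    by (auto simp: XV)
  then have cardA: "card A' = card A"
    using cards(1) by (simp add: A'_def card_image)
  \<comment> \<open>The degrees of \<open>Inr i\<close> in \<open>X\<close> and of
    \<open>p (Inr i)\<close> in \<open>G\<close> agree, and both exceed the degree inside the
    respective class by \<open>card A\<close>.\<close>
  ultimately have "card (nbhd G (p (Inr i)) \<inter> H') = 2" if "i < m" for i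
    using that blow_up_card_nbhd[OF X XV Xdisj Xbu, of "Inr i"] deg[of "Inr i"]
      blow_up_card_nbhd[OF G(1) GV Gdisj Gbu, of "p (Inr i)"] cardA
    by (simp add: H'_def XV card_image)
  then have "\<forall>h\<in>H'. card (nbhd G h \<inter> H') = 2"
    by (auto simp: H'_def)
  moreover have "card H' = m"
    using cards(1)[of "Inr ` {..<m}"] by (simp add: H'_def XV card_image)
  ultimately show ?thesis
    using blow_up_not_has_square[OF G(1) GV Gdisj Gbu] m by simp
qed

section \<open>Chordality and the characterization\<close>

lemma chordal_imp_not_has_square:
  assumes "pair_graph G" "chordal G"
  shows "\<not> has_square G"
proof -
  have "\<not> induced_in (cycle_graph 4) G"
    using assms(2) unfolding chordal_def by (elim allE[of _ 4]) simp
  then show ?thesis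
    using has_square_iff_induced_in[OF assms(1)] by simp
qed

text \<open>An induced cycle of length 4 is itself a C4, and one of length at least 7 contains an
  induced path on six vertices; both make \<open>G\<close> squarable.\<close>

lemma not_chordal_not_squarable:
  assumes G: "pair_graph G" "\<not> squarable G" and "\<not> chordal G"
  obtains c m where "m = 5 \<or> m = 6" "embedding c (cycle_graph m) G"
proof -
  obtain m where m: "m \<ge> 3" "m \<noteq> 3" "induced_in (cycle_graph m) G"
    using assms(3) unfolding chordal_def by blast
  then obtain c where c: "embedding c (cycle_graph m) G"
    using G induced_in_iff_embedding pair_graph_cycle_graph by blast
  have "m \<noteq> 4"
    using m G has_square_iff_induced_in has_square_imp_squarable by blast
  moreover have "\<not> m \<ge> 7"
    using squarable_long_cycle[OF G(1) _ c] G(2) by blast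
  ultimately have "m = 5 \<or> m = 6"
    using m by linarith
  then show thesis
    using that c by blast
qed

theorem theorem6:
  fixes D :: "nat list"
  assumes "is_degree_sequence D"
  shows "excludes D (cycle_graph 4) \<longleftrightarrow>
    forcibly_chordal D \<or>
    (\<exists>(S :: nat pair_pre_digraph) A B.
       split_graph S \<and> split_partition S A B \<and>
       D = degree_sequence (split_compose S A B (cycle_graph 5))) \<or>
    (\<exists>(S :: nat pair_pre_digraph) A B.
       split_graph S \<and> split_partition S A B \<and>
       D = degree_sequence (split_compose S A B (cycle_graph 6)))"
    (is "?L \<longleftrightarrow> ?chordal \<or> ?C5 \<or> ?C6")
proof
  assume L: ?L
  show "?chordal \<or> ?C5 \<or> ?C6"
  proof (cases ?chordal)
    case False
    then obtain G :: "nat pair_pre_digraph" where G: "pair_graph G" "degree_sequence G = D" "\<not> chordal G"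
      unfolding forcibly_chordal_def realization_def by blast
    have nsq: "\<not> squarable G"
      using L G(2) squarable_imp_not_excludes by blast
    obtain c m where "m = 5 \<or> m = 6" "embedding c (cycle_graph m) G"
      using not_chordal_not_squarable[OF G(1) nsq G(3)] .
    then show ?thesis
      using not_squarable_imp_split_compose[OF G(1) nsq] G(2) by metis
  qed simp
next
  assume R: "?chordal \<or> ?C5 \<or> ?C6"
  show ?L
    unfolding excludes_cycle_4_iff
  proof (intro allI impI)
    fix G :: "nat pair_pre_digraph"
    assume "realization G D"
    then have G: "pair_graph G" "degree_sequence G = D"
      by (simp_all add: realization_def)
    from R show "\<not> has_square G"
    proof (elim disjE exE conjE)
      assume ?chordal
      then show ?thesis
        using \<open>realization G D\<close> chordal_imp_not_has_square[OF G(1)] by (simp add: forcibly_chordal_def)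
    qed (use not_has_square_of_split_compose G in metis)+
  qed
qed

end
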